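(* Let $\mathcal{GD}$ be a GDIFS with vertices $v_1,\dots,v_N$, contractions $(f_e)_{e\in E^1}$ with contraction ratios $\rho_e$, and condensation sets $C_1,\dots,C_N$ such that $\overline{\dim}_B(C_i)=\overline{\dim}_B(C_j)$ for all $1\le i,j\le N$. Let $(F_1,\dots,F_N)$ be its inhomogeneous GD fractal set, $(F_{\phi_1},\dots,F_{\phi_N})$ the corresponding homogeneous GD fractal set, and $s^*$ its Mauldin-Williams graph dimension. Then for all $1\le i\le N$, $$\max\{\overline{\dim}_B(F_{\phi_i}),\overline{\dim}_B(C_i)\}\le\overline{\dim}_B(F_i)\le\max\{s^*,\overline{\dim}_B(C_i)\}.$$
   Context: Graph. $V=\{v_1,\dots,v_N\}$ is the vertex set of a finite directed graph (parallel edges and loops allowed) that is strongly connected: any vertex can be joined to any vertex by a directed path. $E^1$ is the set of edges; $i(e)$ and $t(e)$ are the initial and terminal vertices of an edge $e$. $E_i^1$ is the set of edges with initial vertex $v_i$; $E_{ij}^1$ is the set of edges from $v_i$ to $v_j$. A quantity indexed by a vertex $v_j$ may be indexed by $j$. GDIFS. To each vertex $v_j$ is attached a complete metric space $(X_{v_j},d_{v_j})$, a copy of $\mathbb{R}^n$ with the Euclidean metric, and to each edge $e\in E^1$ a contraction $f_e:X_{t(e)}\to X_{i(e)}$ with contraction ratio $\rho_e\in[0,1)$. Condensation sets $C_j\subset X_{v_j}$, $1\le j\le N$, are fixed non-empty compact sets. Fractal sets: $(F_1,\dots,F_N)$ is the unique list of non-empty compact sets $F_j\subset X_{v_j}$ with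 $F_j=\bigcup_{e\in E_j^1}f_e(F_{t(e)})\cup C_j$ for all $j$; $(F_{\phi_1},\dots,F_{\phi_N})$ is the unique list of non-empty compact sets $F_{\phi_j}\subset X_{v_j}$ with $F_{\phi_j}=\bigcup_{e\in E_j^1}f_e(F_{\phi_{t(e)}})$ for all $j$. Mauldin-Williams graph dimension: for $s\ge0$ let $\mathcal M(s)$ be the $N\times N$ matrix with entries $\mathcal M_{v_iv_j}(s)=\sum_{e\in E_{ij}^1}\rho_e^s$ and $\Phi(s)$ its spectral radius. $\Phi$ is taken to be continuous and strictly decreasing with $\Phi(0)\ge1$ and $\Phi(s)\to0$ as $s\to\infty$; $s^*$ is the unique positive real number with $\Phi(s^* )=1$. Upper box dimension of a non-empty bounded set $S$: $\overline{\dim}_B(S)=\limsup_{\delta\to0^+}\frac{\log N_\delta(S)}{-\log\delta}$, where $N_\delta(S)$ is the minimum number of sets of diameter (at most) $\delta$ needed to cover $S$. *)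

theory Defs
  imports
    "HOL-Analysis.Analysis"
    "Graph_Theory.Digraph_Component"
    "Jordan_Normal_Form.Spectral_Radius"
begin

text \<open>
  Covering sets are required to be bounded because \<^const>\<open>diameter\<close> is only meaningful for
  bounded sets (an unbounded set must not pass as a set of small diameter).
\<close>

definition covering_number :: "real \<Rightarrow> 'a::metric_space set \<Rightarrow> nat" where
  "covering_number \<delta> S =
     (LEAST k. \<exists>\<U>. finite \<U> \<and> card \<U> = k \<and> S \<subseteq> \<Union>\<U> \<and> (\<forall>U\<in>\<U>. bounded U \<and> diameter U \<le> \<delta>))"

definition upper_box_dim :: "'a::metric_space set \<Rightarrow> ereal" where
  "upper_box_dim S =
     Limsup (at_right 0) (\<lambda>\<delta>::real. ereal (ln (real (covering_number \<delta> S)) / (- ln \<delta>)))"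

text \<open>
  Graph-directed iterated function systems with condensation on copies of Euclidean space.
  The graph is a multidigraph in which loops and parallel edges are allowed, \<open>v\<close> enumerates its
  vertices as \<open>v 1, \<dots>, v N\<close>, and \<open>f e\<close> maps the copy of the space at the head of \<open>e\<close> into the
  copy at its tail. Since all the spaces are copies of the same space, they share one type and
  subsets of them are told apart by their vertex index.
\<close>

locale gdifs =
  fixes G :: "('v, 'e) pre_digraph"
    and N :: nat
    and v :: "nat \<Rightarrow> 'v"
    and f :: "'e \<Rightarrow> real ^ 'n \<Rightarrow> real ^ 'n"
    and \<rho> :: "'e \<Rightarrow> real"
    and C :: "'v \<Rightarrow> (real ^ 'n) set"
  assumes finite_graph: "fin_digraph G"
    and enumeration: "bij_betw v {1..N} (verts G)"
    and connected: "strongly_connected G"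
    and contraction: "\<And>e. e \<in> arcs G \<Longrightarrow> (\<rho> e)-lipschitz_on UNIV (f e)"
    and ratio: "\<And>e. e \<in> arcs G \<Longrightarrow> 0 \<le> \<rho> e \<and> \<rho> e < 1"
    and condensation: "\<And>u. u \<in> verts G \<Longrightarrow> C u \<noteq> {} \<and> compact (C u)"

definition inhomogeneous_gd_fractal ::
  "('v, 'e) pre_digraph \<Rightarrow> ('e \<Rightarrow> real ^ 'n \<Rightarrow> real ^ 'n) \<Rightarrow> ('v \<Rightarrow> (real ^ 'n) set)
     \<Rightarrow> ('v \<Rightarrow> (real ^ 'n) set) \<Rightarrow> bool" where
  "inhomogeneous_gd_fractal G f C F \<longleftrightarrow>
     (\<forall>u\<in>verts G. F u \<noteq> {} \<and> compact (F u) \<and>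
        F u = (\<Union>e\<in>out_arcs G u. f e ` F (head G e)) \<union> C u)"

definition homogeneous_gd_fractal ::
  "('v, 'e) pre_digraph \<Rightarrow> ('e \<Rightarrow> real ^ 'n \<Rightarrow> real ^ 'n) \<Rightarrow> ('v \<Rightarrow> (real ^ 'n) set) \<Rightarrow> bool" where
  "homogeneous_gd_fractal G f F \<longleftrightarrow>
     (\<forall>u\<in>verts G. F u \<noteq> {} \<and> compact (F u) \<and>
        F u = (\<Union>e\<in>out_arcs G u. f e ` F (head G e)))"

text \<open>
  Library matrices are indexed from 0, hence the shift in the indices. The entries are embedded
  in the complex numbers, over which the library defines the spectral radius. As
  \<open>0 powr s = 0\<close> for every \<open>s\<close>, an edge of ratio 0 contributes nothing, also at \<open>s = 0\<close>;
  this is the convention under which the entries are continuous on \<open>[0, \<infinity>)\<close>.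
\<close>

definition mw_matrix ::
  "('v, 'e) pre_digraph \<Rightarrow> nat \<Rightarrow> (nat \<Rightarrow> 'v) \<Rightarrow> ('e \<Rightarrow> real) \<Rightarrow> real \<Rightarrow> complex mat" where
  "mw_matrix G N v \<rho> s =
     Matrix.mat N N (\<lambda>(i, j).
       complex_of_real (\<Sum>e | e \<in> arcs G \<and> tail G e = v (Suc i) \<and> head G e = v (Suc j). \<rho> e powr s))"

definition mw_spectral_radius ::
  "('v, 'e) pre_digraph \<Rightarrow> nat \<Rightarrow> (nat \<Rightarrow> 'v) \<Rightarrow> ('e \<Rightarrow> real) \<Rightarrow> real \<Rightarrow> real" where
  "mw_spectral_radius G N v \<rho> s = spectral_radius (mw_matrix G N v \<rho> s)"

definition is_mw_dimension ::
  "('v, 'e) pre_digraph \<Rightarrow> nat \<Rightarrow> (nat \<Rightarrow> 'v) \<Rightarrow> ('e \<Rightarrow> real) \<Rightarrow> real \<Rightarrow> bool" where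
  "is_mw_dimension G N v \<rho> s \<longleftrightarrow> 0 < s \<and> mw_spectral_radius G N v \<rho> s = 1"

end

(* The homogeneous fractal is contained in the inhomogeneous one (iterate the contractions on the
   distance between the two), so the lower bound is monotonicity of the upper box dimension.

   For the upper bound let t exceed s and the dimension of the condensation sets, and let
   s < t' < t. The matrix M(t') has spectral radius below 1, hence bounded powers, and discounting
   these by q = r^(t-t'), where r < 1 bounds all ratios, gives a convergent sum
   h = \<Sum>k q^k M(t')^k 1 with h \<ge> 1 and M(t) h \<le> h - 1. Splitting F_u into its pieces f_e(F_t(e)) and
   C_u bounds the covering number of F_u at scale \<delta> by those of the F_t(e) at the larger scales
   \<delta>/\<rho>_e, and the slack -1 absorbs the cost of C_u and of the pieces with \<delta>/\<rho>_e no longer small,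
   so that K h_u \<delta>^(-t) is a bound at all small scales, by induction on the scale. *)

theory Submission
  imports Defs
begin

section \<open>Covering numbers of compact sets\<close>

lemma covering_number_le_card:
  assumes "finite \<U>" "S \<subseteq> \<Union>\<U>" "\<forall>U\<in>\<U>. bounded U \<and> diameter U \<le> \<delta>"
  shows "covering_number \<delta> S \<le> card \<U>"
  unfolding covering_number_def by (rule Least_le) (use assms in blast)

lemma diameter_image_le:
  fixes f :: "'a::metric_space \<Rightarrow> 'b::metric_space"
  assumes "L-lipschitz_on U f" "bounded U"
  shows "bounded (f ` U)" "diameter (f ` U) \<le> L * diameter U"
proof -
  have d: "dist (f x) (f y) \<le> L * diameter U" if "x \<in> U" "y \<in> U" for x y
    using lipschitz_onD[OF assms(1) that] diameter_bounded_bound[OF assms(2) that]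
      lipschitz_on_nonneg[OF assms(1)] by (meson mult_left_mono order_trans)
  show "bounded (f ` U)"
    unfolding bounded_two_points using d by blast
  show "diameter (f ` U) \<le> L * diameter U"
  proof (cases "U = {}")
    case False
    then show ?thesis
      unfolding diameter_def[of "f ` U"] using d by (auto intro!: cSUP_least)
  qed simp
qed

text \<open>Compactness gives a finite cover by balls of radius \<open>\<delta>/2\<close>. Hence the
  set under \<open>LEAST\<close> is non-empty, and the covering number is attained by an actual
  cover.\<close>

lemma compact_obtain_cover:
  fixes S :: "'a::metric_space set"
  assumes "compact S" "\<delta> > 0"
  obtains \<U> where "finite \<U>" "card \<U> = covering_number \<delta> S" "S \<subseteq> \<Union>\<U>"
    "\<forall>U\<in>\<U>. bounded U \<and> diameter U \<le> \<delta>"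
proof -
  obtain X where X: "finite X" "S \<subseteq> (\<Union>x\<in>X. ball x (\<delta>/2))"
    using compactE_image[OF assms(1), of S "\<lambda>x. ball x (\<delta>/2)"] assms(2)
    by (metis UN_I centre_in_ball half_gt_zero open_ball subsetI)
  have "diameter (ball x (\<delta>/2)) \<le> \<delta>" for x :: 'a
  proof -
    have "dist y z \<le> \<delta>" if "dist x y < \<delta>/2" "dist x z < \<delta>/2" for y z
      using that dist_triangle[of y z x] by (simp add: dist_commute)
    then show ?thesis
      using assms(2) unfolding diameter_def by (auto intro!: cSUP_least)
  qed
  then have "\<exists>\<U>. finite \<U> \<and> card \<U> = card ((\<lambda>x. ball x (\<delta>/2)) ` X) \<and> S \<subseteq> \<Union>\<U> \<and>
      (\<forall>U\<in>\<U>. bounded U \<and> diameter U \<le> \<delta>)"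
    using X by (intro exI[of _ "(\<lambda>x. ball x (\<delta>/2)) ` X"]) auto
  then have "\<exists>\<U>. finite \<U> \<and> card \<U> = covering_number \<delta> S \<and> S \<subseteq> \<Union>\<U> \<and>
      (\<forall>U\<in>\<U>. bounded U \<and> diameter U \<le> \<delta>)"
    unfolding covering_number_def by (rule LeastI)
  then show thesis using that by blast
qed

lemma covering_number_mono:
  assumes "compact S" "T \<subseteq> S" "\<delta> > 0"
  shows "covering_number \<delta> T \<le> covering_number \<delta> S"
proof -
  obtain \<U> where "finite \<U>" "card \<U> = covering_number \<delta> S" "S \<subseteq> \<Union>\<U>"
    "\<forall>U\<in>\<U>. bounded U \<and> diameter U \<le> \<delta>"
    using compact_obtain_cover[OF assms(1,3)] .
  then show ?thesis using covering_number_le_card[of \<U> T \<delta>] assms(2) by auto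
qed

text \<open>Positivity allows logarithms of covering numbers to be compared and undone by
  \<open>exp\<close>.\<close>

lemma covering_number_pos:
  assumes "compact S" "S \<noteq> {}" "\<delta> > 0"
  shows "covering_number \<delta> S > 0"
proof -
  obtain \<U> where "finite \<U>" "card \<U> = covering_number \<delta> S" "S \<subseteq> \<Union>\<U>"
    using compact_obtain_cover[OF assms(1,3)] .
  then show ?thesis using assms(2) by (metis Sup_empty card_gt_0_iff subset_empty)
qed

lemma covering_number_Un_le:
  assumes "compact S" "compact T" "\<delta> > 0"
  shows "covering_number \<delta> (S \<union> T) \<le> covering_number \<delta> S + covering_number \<delta> T"
proof -
  obtain \<U> where U: "finite \<U>" "card \<U> = covering_number \<delta> S" "S \<subseteq> \<Union>\<U>"
    "\<forall>U\<in>\<U>. bounded U \<and> diameter U \<le> \<delta>"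
    using compact_obtain_cover[OF assms(1,3)] .
  obtain \<V> where V: "finite \<V>" "card \<V> = covering_number \<delta> T" "T \<subseteq> \<Union>\<V>"
    "\<forall>U\<in>\<V>. bounded U \<and> diameter U \<le> \<delta>"
    using compact_obtain_cover[OF assms(2,3)] .
  have "covering_number \<delta> (S \<union> T) \<le> card (\<U> \<union> \<V>)"
    using U V by (intro covering_number_le_card) auto
  then show ?thesis using card_Un_le[of \<U> \<V>] U(2) V(2) by linarith
qed

lemma covering_number_UN_le:
  assumes "finite I" "\<And>i. i \<in> I \<Longrightarrow> compact (S i)" "\<delta> > 0"
  shows "covering_number \<delta> (\<Union>i\<in>I. S i) \<le> (\<Sum>i\<in>I. covering_number \<delta> (S i))"
  using assms(1,2)
proof (induction I rule: finite_induct)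
  case empty
  then show ?case using covering_number_le_card[of "{}" "{}" \<delta>] by simp
next
  case (insert i I)
  have "covering_number \<delta> (S i \<union> (\<Union>i\<in>I. S i))
      \<le> covering_number \<delta> (S i) + covering_number \<delta> (\<Union>i\<in>I. S i)"
    using insert assms(3) by (intro covering_number_Un_le compact_UN) auto
  then show ?case using insert by fastforce
qed

text \<open>The images of a cover at scale \<epsilon> have diameter at most
  \<open>L * \<epsilon>\<close>. Keeping \<epsilon> free, instead of fixing it as \<delta>/L,
  includes the case \<open>L = 0\<close>.\<close>

lemma covering_number_lipschitz_image_le:
  fixes f :: "'a::metric_space \<Rightarrow> 'b::metric_space"
  assumes "L-lipschitz_on S f" "compact S" "\<epsilon> > 0" "L * \<epsilon> \<le> \<delta>"
  shows "covering_number \<delta> (f ` S) \<le> covering_number \<epsilon> S"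
proof -
  obtain \<U> where U: "finite \<U>" "card \<U> = covering_number \<epsilon> S" "S \<subseteq> \<Union>\<U>"
    "\<forall>U\<in>\<U>. bounded U \<and> diameter U \<le> \<epsilon>"
    using compact_obtain_cover[OF assms(2,3)] .
  \<comment> \<open>The covering sets are cut down to \<open>S\<close>, since the Lipschitz bound
    holds only there.\<close>
  have "bounded (f ` (U \<inter> S)) \<and> diameter (f ` (U \<inter> S)) \<le> \<delta>" if "U \<in> \<U>" for U
  proof -
    have lip: "L-lipschitz_on (U \<inter> S) f" and b: "bounded (U \<inter> S)"
      using lipschitz_on_subset[OF assms(1)] bspec[OF U(4) that] by (auto simp: bounded_Int)
    have "diameter (U \<inter> S) \<le> \<epsilon>"
      using bspec[OF U(4) that] diameter_subset[of "U \<inter> S" U] by force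
    then have "L * diameter (U \<inter> S) \<le> \<delta>"
      using lipschitz_on_nonneg[OF assms(1)] assms(4) by (meson mult_left_mono order_trans)
    then show ?thesis using diameter_image_le[OF lip b] by auto
  qed
  moreover have "f ` S \<subseteq> \<Union>((\<lambda>U. f ` (U \<inter> S)) ` \<U>)"
    using U(3) by blast
  ultimately have "covering_number \<delta> (f ` S) \<le> card ((\<lambda>U. f ` (U \<inter> S)) ` \<U>)"
    using U(1) by (intro covering_number_le_card) auto
  also have "\<dots> \<le> covering_number \<epsilon> S"
    using card_image_le[OF U(1)] U(2) by metis
  finally show ?thesis .
qed

section \<open>Upper box dimension and power bounds on covering numbers\<close>

lemma upper_box_dim_mono:
  assumes "compact S" "T \<subseteq> S" "compact T" "T \<noteq> {}"
  shows "upper_box_dim T \<le> upper_box_dim S"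
  unfolding upper_box_dim_def
proof (rule Limsup_mono)
  have "eventually (\<lambda>\<delta>::real. 0 < \<delta> \<and> \<delta> < 1) (at_right 0)"
    by (auto simp: eventually_at_right_field intro: exI[of _ 1])
  then show "eventually (\<lambda>\<delta>. ereal (ln (real (covering_number \<delta> T)) / - ln \<delta>)
      \<le> ereal (ln (real (covering_number \<delta> S)) / - ln \<delta>)) (at_right 0)"
  proof eventually_elim
    case (elim \<delta>)
    then have "ln (real (covering_number \<delta> T)) \<le> ln (real (covering_number \<delta> S))"
      using covering_number_mono[OF assms(1,2), of \<delta>] covering_number_pos[OF assms(3,4), of \<delta>]
      by (intro ln_mono) auto
    then show ?case using elim by (simp add: divide_right_mono_neg)
  qed
qed

text \<open>Taking logarithms leaves \<open>t\<close> plus \<open>ln K / - ln \<delta>\<close>; the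
  latter tends to 0 with \<delta>, so the constant \<open>K\<close> does not affect the
  dimension.\<close>

lemma upper_box_dim_leI:
  assumes "compact S" "S \<noteq> {}" "K > 0" "\<delta>\<^sub>0 > 0"
    and "\<And>\<delta>. 0 < \<delta> \<Longrightarrow> \<delta> < \<delta>\<^sub>0 \<Longrightarrow> real (covering_number \<delta> S) \<le> K * \<delta> powr (-t)"
  shows "upper_box_dim S \<le> ereal t"
proof -
  have "eventually (\<lambda>\<delta>::real. 0 < \<delta> \<and> \<delta> < min 1 \<delta>\<^sub>0) (at_right 0)"
    using assms(4) by (auto simp: eventually_at_right_field intro: exI[of _ "min 1 \<delta>\<^sub>0"])
  then have "eventually (\<lambda>\<delta>. ereal (ln (real (covering_number \<delta> S)) / - ln \<delta>)
      \<le> ereal (ln K / - ln \<delta> + t)) (at_right 0)"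
  proof eventually_elim
    case (elim \<delta>)
    then have "ln (real (covering_number \<delta> S)) \<le> ln (K * \<delta> powr (-t))"
      using assms(5)[of \<delta>] covering_number_pos[OF assms(1,2), of \<delta>] assms(3)
      by (intro ln_mono) auto
    also have "\<dots> = ln K + (-t) * ln \<delta>"
      using elim assms(3) by (simp add: ln_mult ln_powr)
    finally have "ln (real (covering_number \<delta> S)) / - ln \<delta> \<le> (ln K + (-t) * ln \<delta>) / - ln \<delta>"
      using elim by (intro divide_right_mono) auto
    also have "\<dots> = ln K / - ln \<delta> + t"
      using elim by (simp add: field_simps)
    finally show ?case by simp
  qed
  then have "upper_box_dim S \<le> Limsup (at_right 0) (\<lambda>\<delta>. ereal (ln K / - ln \<delta> + t))"
    unfolding upper_box_dim_def by (rule Limsup_mono)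
  also have "\<dots> = ereal t"
  proof (rule lim_imp_Limsup)
    have "filterlim (\<lambda>\<delta>::real. - ln \<delta>) at_top (at_right 0)"
      using ln_at_0 by (simp add: filterlim_uminus_at_top)
    then have "((\<lambda>\<delta>. ln K / - ln \<delta>) \<longlongrightarrow> 0) (at_right 0)"
      by (intro tendsto_divide_0[OF tendsto_const] filterlim_at_top_imp_at_infinity)
    from tendsto_add[OF this tendsto_const[of t]]
    show "((\<lambda>\<delta>. ereal (ln K / - ln \<delta> + t)) \<longlongrightarrow> ereal t) (at_right 0)"
      by simp
  qed simp
  finally show ?thesis .
qed

text \<open>A limsup strictly below \<open>t\<close> keeps the quotients below \<open>t\<close> at
  all small scales. Multiplying by \<open>- ln \<delta>\<close>, which is positive for \<delta> < 1,
  and exponentiating gives a power bound with constant 1.\<close>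

lemma upper_box_dim_lessD:
  assumes "compact S" "S \<noteq> {}" "upper_box_dim S < ereal t"
  shows "eventually (\<lambda>\<delta>. real (covering_number \<delta> S) \<le> \<delta> powr (-t)) (at_right 0)"
proof -
  have "eventually (\<lambda>\<delta>::real. 0 < \<delta> \<and> \<delta> < 1) (at_right 0)"
    by (auto simp: eventually_at_right_field intro: exI[of _ 1])
  with Limsup_lessD[OF assms(3)[unfolded upper_box_dim_def]] show ?thesis
  proof eventually_elim
    case (elim \<delta>)
    then have "ln (real (covering_number \<delta> S)) \<le> - t * ln \<delta>"
      by (simp add: field_simps)
    then have "exp (ln (real (covering_number \<delta> S))) \<le> exp (- t * ln \<delta>)"
      by (simp only: exp_le_cancel_iff)
    then show ?case
      using elim covering_number_pos[OF assms(1,2), of \<delta>] by (simp add: powr_def)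
  qed
qed

lemma mult_mat_vec_ones_index:
  fixes A :: "'a::semiring_1 mat"
  assumes "A \<in> carrier_mat n m" "i < n"
  shows "vec_index (A *\<^sub>v vec m (\<lambda>_. 1)) i = (\<Sum>j<m. A $$ (i, j))"
  using assms by (auto simp: scalar_prod_def atLeast0LessThan)

section \<open>Inclusion of the homogeneous fractal in the inhomogeneous one\<close>

context gdifs
begin

interpretation fin_digraph G by (rule finite_graph)

lemma ratio_uniform:
  obtains r where "0 < r" "r < 1" "\<forall>e\<in>arcs G. \<rho> e \<le> r"
proof -
  \<comment> \<open>The \<open>1/2\<close> keeps the maximum defined for a graph without arcs, and
    positive when all ratios are 0.\<close>
  let ?r = "Max (insert (1/2) (\<rho> ` arcs G))"
  have "?r < 1" using ratio by auto
  moreover have "1/2 \<le> ?r" by (rule Max_ge) auto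
  moreover have "\<forall>e\<in>arcs G. \<rho> e \<le> ?r" by auto
  ultimately show thesis by (intro that[of ?r]) linarith+
qed

text \<open>A point of the homogeneous fractal is traced back along \<open>k\<close> edges; any
  point of the inhomogeneous fractal at the vertex reached is pushed forward along the same edges.
  It ends in \<open>F u\<close>, within \<open>r ^ k\<close> times a fixed diameter of the original
  point, and \<open>F u\<close> is closed.\<close>

lemma homogeneous_subset_inhomogeneous:
  assumes hom: "homogeneous_gd_fractal G f F\<^sub>\<phi>" and inh: "inhomogeneous_gd_fractal G f C F"
    and u: "u \<in> verts G"
  shows "F\<^sub>\<phi> u \<subseteq> F u"
proof
  fix x assume x: "x \<in> F\<^sub>\<phi> u"
  obtain r where r: "0 < r" "r < 1" "\<forall>e\<in>arcs G. \<rho> e \<le> r"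
    using ratio_uniform by blast
  have cF: "compact (F w)" "F w \<noteq> {}" and cP: "compact (F\<^sub>\<phi> w)" if "w \<in> verts G" for w
    using hom inh that unfolding homogeneous_gd_fractal_def inhomogeneous_gd_fractal_def by blast+
  \<comment> \<open>One bounded set contains the fractals at all vertices, so its diameter bounds
    the initial distance wherever the backward path ends.\<close>
  define B where "B = (\<Union>w\<in>verts G. F w \<union> F\<^sub>\<phi> w)"
  have B: "bounded B"
    unfolding B_def using cF cP by (intro compact_imp_bounded compact_UN compact_Un) auto
  have approx: "\<exists>z\<in>F w. dist y z \<le> r ^ k * diameter B"
    if "w \<in> verts G" "y \<in> F\<^sub>\<phi> w" for k w y
    using that
  proof (induction k arbitrary: w y)
    case 0
    obtain z where "z \<in> F w" using cF 0 by blast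
    then show ?case
      using 0 diameter_bounded_bound[OF B, of y z] by (auto simp: B_def)
  next
    case (Suc k)
    then obtain e y' where e: "e \<in> out_arcs G w" "y' \<in> F\<^sub>\<phi> (head G e)" "y = f e y'"
      using hom unfolding homogeneous_gd_fractal_def by blast
    then have eG: "e \<in> arcs G" by simp
    then obtain z' where z': "z' \<in> F (head G e)" "dist y' z' \<le> r ^ k * diameter B"
      using Suc.IH[OF head_in_verts e(2)] by blast
    have "f e z' \<in> F w"
      using inh Suc.prems(1) e(1) z'(1) unfolding inhomogeneous_gd_fractal_def by blast
    moreover have "dist y (f e z') \<le> r * (r ^ k * diameter B)"
    proof -
      have "dist y (f e z') \<le> \<rho> e * dist y' z'"
        using lipschitz_onD[OF contraction[OF eG]] e(3) by simp
      also have "\<dots> \<le> r * (r ^ k * diameter B)"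
        using r(1) bspec[OF r(3) eG] z'(2) by (intro mult_mono) auto
      finally show ?thesis .
    qed
    ultimately show ?case by (auto simp: mult.assoc)
  qed
  have "infdist x (F u) \<le> r ^ k * diameter B" for k
    using approx[OF u x, of k] infdist_le2 by blast
  moreover have "(\<lambda>k. r ^ k * diameter B) \<longlonglongrightarrow> 0"
    using r by (intro tendsto_mult_left_zero LIMSEQ_realpow_zero) auto
  ultimately have "infdist x (F u) \<le> 0"
    by (intro LIMSEQ_le_const) auto
  then show "x \<in> F u"
    using cF[OF u] infdist_nonneg[of x "F u"]
    by (simp add: in_closed_iff_infdist_zero compact_imp_closed)
qed

section \<open>Weighted walks and powers of the Mauldin-Williams matrix\<close>

text \<open>The total weight of the walks of length \<open>k\<close> from \<open>u\<close>, each
  weighted by the product of \<open>\<rho> e powr t\<close> over its edges. These are the row sums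
  of the \<open>k\<close>-th power of M(t), kept real and indexed by vertices.\<close>

primrec walk_weight :: "real \<Rightarrow> nat \<Rightarrow> 'v \<Rightarrow> real" where
  "walk_weight t 0 u = 1"
| "walk_weight t (Suc k) u = (\<Sum>e\<in>out_arcs G u. \<rho> e powr t * walk_weight t k (head G e))"

lemma walk_weight_nonneg: "0 \<le> walk_weight t k u"
  by (induction k arbitrary: u) (auto intro!: sum_nonneg)

text \<open>Grouping the edges out of \<open>u\<close> by their heads identifies a matrix row
  applied to \<open>w\<close> with one sum over edges. The shift to \<open>Suc j\<close> matches
  matrix indices from 0 with an enumeration from 1.\<close>

lemma mw_matrix_row_sum:
  "(\<Sum>j<N. (\<Sum>e | e \<in> arcs G \<and> tail G e = u \<and> head G e = v (Suc j). \<rho> e powr t) * w (v (Suc j)))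
     = (\<Sum>e\<in>out_arcs G u. \<rho> e powr t * w (head G e))"
proof -
  have bij: "bij_betw (\<lambda>j. v (Suc j)) {..<N} (verts G)"
    using bij_betw_trans[OF _ enumeration, of Suc "{..<N}"]
    by (simp add: o_def image_Suc_lessThan bij_betw_def)
  have "(\<Sum>j<N. (\<Sum>e | e \<in> arcs G \<and> tail G e = u \<and> head G e = v (Suc j). \<rho> e powr t) * w (v (Suc j)))
      = (\<Sum>x\<in>verts G. (\<Sum>e | e \<in> arcs G \<and> tail G e = u \<and> head G e = x. \<rho> e powr t) * w x)"
    by (rule sum.reindex_bij_betw[OF bij])
  also have "\<dots> = (\<Sum>x\<in>verts G. \<Sum>e | e \<in> out_arcs G u \<and> head G e = x. \<rho> e powr t * w (head G e))"
    by (auto simp: sum_distrib_right conj_ac intro!: sum.cong)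
  also have "\<dots> = (\<Sum>e\<in>out_arcs G u. \<rho> e powr t * w (head G e))"
    by (rule sum.group) auto
  finally show ?thesis .
qed

lemma mw_matrix_carrier: "mw_matrix G N v \<rho> t \<in> carrier_mat N N"
  by (simp add: mw_matrix_def)

lemma walk_weight_Suc_index:
  "complex_of_real (walk_weight t (Suc k) (v (Suc i)))
     = (\<Sum>j<N. complex_of_real (\<Sum>e | e \<in> arcs G \<and> tail G e = v (Suc i) \<and> head G e = v (Suc j).
          \<rho> e powr t) * complex_of_real (walk_weight t k (v (Suc j))))"
  by (simp flip: mw_matrix_row_sum[where w = "walk_weight t k"] add: of_real_sum of_real_mult)

lemma mw_matrix_power_ones:
  "mw_matrix G N v \<rho> t ^\<^sub>m k *\<^sub>v vec N (\<lambda>_. 1)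
     = vec N (\<lambda>i. complex_of_real (walk_weight t k (v (Suc i))))"
proof (induction k)
  case 0
  then show ?case by (simp add: mw_matrix_def)
next
  case (Suc k)
  let ?M = "mw_matrix G N v \<rho> t"
  have M: "?M \<in> carrier_mat N N" by (rule mw_matrix_carrier)
  \<comment> \<open>The matrix power appends its new factor on the right, whereas
    \<open>walk_weight\<close> puts the new edge first, so the factor has to be moved to the
    left.\<close>
  have comm: "?M ^\<^sub>m k * ?M = ?M * ?M ^\<^sub>m k" for k
  proof (induction k)
    case (Suc k)
    then show ?case
      by (simp add: Suc assoc_mult_mat[OF M pow_carrier_mat[OF M] M])
  qed (use M in simp)
  have "?M ^\<^sub>m Suc k *\<^sub>v vec N (\<lambda>_. 1) = ?M *\<^sub>v (?M ^\<^sub>m k *\<^sub>v vec N (\<lambda>_. 1))"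
    using M by (simp add: comm assoc_mult_mat_vec[OF M pow_carrier_mat[OF M]])
  also have "\<dots> = ?M *\<^sub>v vec N (\<lambda>i. complex_of_real (walk_weight t k (v (Suc i))))"
    by (simp only: Suc)
  also have "\<dots> = vec N (\<lambda>i. complex_of_real (walk_weight t (Suc k) (v (Suc i))))"
    by (rule eq_vecI)
      (simp_all only: walk_weight_Suc_index mw_matrix_def, auto simp: scalar_prod_def atLeast0LessThan)
  finally show ?case .
qed

text \<open>Spectral radius below 1 bounds the entries of all powers by one constant, through the
  Jordan normal form; a walk weight is a sum of \<open>N\<close> such entries.\<close>

lemma walk_weight_bounded:
  assumes "mw_spectral_radius G N v \<rho> t < 1"
  obtains c where "\<And>k u. u \<in> verts G \<Longrightarrow> walk_weight t k u \<le> c"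
proof -
  let ?M = "mw_matrix G N v \<rho> t"
  have M: "?M \<in> carrier_mat N N" by (rule mw_matrix_carrier)
  obtain c where c: "\<And>k. norm_bound (?M ^\<^sub>m k) c"
    using spectral_radius_jnf_norm_bound_less_1_upper_triangular[OF M]
      assms[unfolded mw_spectral_radius_def] by blast
  have "walk_weight t k u \<le> real N * c" if "u \<in> verts G" for k u
  proof -
    obtain i where i: "i < N" "u = v (Suc i)"
    proof -
      obtain m where "m \<in> {1..N}" "u = v m"
        using enumeration \<open>u \<in> verts G\<close> unfolding bij_betw_def by blast
      then show thesis using that[of "m - 1"] by auto
    qed
    have P: "?M ^\<^sub>m k \<in> carrier_mat N N" using M by simp
    have "complex_of_real (walk_weight t k u) = vec_index (?M ^\<^sub>m k *\<^sub>v vec N (\<lambda>_. 1)) i"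
      using i by (simp add: mw_matrix_power_ones)
    also have "\<dots> = (\<Sum>j<N. (?M ^\<^sub>m k) $$ (i, j))"
      using mult_mat_vec_ones_index[OF P i(1)] .
    \<comment> \<open>The complex row sum is a non-negative real, hence equal to its norm.\<close>
    finally have "walk_weight t k u = norm (\<Sum>j<N. (?M ^\<^sub>m k) $$ (i, j))"
      using walk_weight_nonneg[of t k u] by (metis abs_of_nonneg norm_of_real)
    also have "\<dots> \<le> (\<Sum>j<N. c)"
      using c[of k] carrier_matD[OF M] i by (intro sum_norm_le) (auto simp: norm_bound_def)
    finally show ?thesis by simp
  qed
  then show thesis using that by blast
qed

text \<open>The series satisfies h = 1 + q M(t') h, and M(t) \<le> q M(t') entrywise because each
  \<rho>_e^(t-t') is at most q; together these give M(t) h \<le> h - 1. Bounded powers alone would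
  not make the series converge: the gap between t' and t supplies the geometric factor.\<close>

lemma subinvariant_weight:
  assumes "mw_spectral_radius G N v \<rho> t' < 1" "t' < t"
  obtains h where "\<And>u. u \<in> verts G \<Longrightarrow> 1 \<le> h u"
    and "\<And>u. u \<in> verts G \<Longrightarrow> (\<Sum>e\<in>out_arcs G u. \<rho> e powr t * h (head G e)) \<le> h u - 1"
proof -
  obtain c where c: "\<And>k u. u \<in> verts G \<Longrightarrow> walk_weight t' k u \<le> c"
    using walk_weight_bounded[OF assms(1)] by blast
  obtain r where r: "0 < r" "r < 1" "\<forall>e\<in>arcs G. \<rho> e \<le> r"
    using ratio_uniform by blast
  define q where "q = r powr (t - t')"
  have q: "0 < q" "q < 1"
    using r assms(2) powr_less_mono2[of "t - t'" r 1] by (auto simp: q_def)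
  define h where "h u = (\<Sum>k. q ^ k * walk_weight t' k u)" for u
  have summ: "summable (\<lambda>k. q ^ k * walk_weight t' k u)" if "u \<in> verts G" for u
  proof (rule summable_comparison_test)
    show "summable (\<lambda>k. q ^ k * c)"
      using q by (intro summable_mult2 summable_geometric) simp
    show "\<exists>n0. \<forall>k\<ge>n0. norm (q ^ k * walk_weight t' k u) \<le> q ^ k * c"
      using q c[OF that] walk_weight_nonneg[of t' _ u] by (auto intro!: mult_left_mono)
  qed
  have h_eq: "h u = 1 + q * (\<Sum>e\<in>out_arcs G u. \<rho> e powr t' * h (head G e))"
    if "u \<in> verts G" for u
  proof -
    have "(\<lambda>k. \<Sum>e\<in>out_arcs G u. \<rho> e powr t' * (q ^ k * walk_weight t' k (head G e)))
        sums (\<Sum>e\<in>out_arcs G u. \<rho> e powr t' * h (head G e))"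
      unfolding h_def using summ by (intro sums_sum sums_mult summable_sums) auto
    then have "(\<lambda>k. q * (\<Sum>e\<in>out_arcs G u. \<rho> e powr t' * (q ^ k * walk_weight t' k (head G e))))
        sums (q * (\<Sum>e\<in>out_arcs G u. \<rho> e powr t' * h (head G e)))"
      by (rule sums_mult)
    moreover have "q * (\<Sum>e\<in>out_arcs G u. \<rho> e powr t' * (q ^ k * walk_weight t' k (head G e)))
        = q ^ Suc k * walk_weight t' (Suc k) u" for k
      by (simp add: sum_distrib_left mult_ac)
    ultimately have "(\<lambda>k. q ^ Suc k * walk_weight t' (Suc k) u)
        sums (q * (\<Sum>e\<in>out_arcs G u. \<rho> e powr t' * h (head G e)))"
      by simp
    \<comment> \<open>The shifted series lacks the term for \<open>k = 0\<close>, which is the 1 in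
      the equation.\<close>
    from sums_Suc[OF this] show ?thesis
      unfolding h_def[of u] by (simp add: sums_iff)
  qed
  have h_nonneg: "0 \<le> h u" if "u \<in> verts G" for u
    unfolding h_def using q walk_weight_nonneg by (intro suminf_nonneg summ that) auto
  show thesis
  proof (rule that[of h])
    fix u assume u: "u \<in> verts G"
    show "1 \<le> h u"
      using h_nonneg q by (subst h_eq[OF u]) (auto intro!: mult_nonneg_nonneg sum_nonneg)
    have "\<rho> e powr t * h (head G e) \<le> q * (\<rho> e powr t' * h (head G e))" if "e \<in> out_arcs G u" for e
    proof -
      have e: "e \<in> arcs G" using that by simp
      \<comment> \<open>This includes ratio 0, where all the powers are 0.\<close>
      have "\<rho> e powr t = \<rho> e powr (t - t') * \<rho> e powr t'"
        by (simp flip: powr_add)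
      also have "\<dots> \<le> q * \<rho> e powr t'"
        unfolding q_def using r e ratio[OF e] assms(2)
        by (intro mult_right_mono powr_mono2) auto
      finally show ?thesis
        using h_nonneg[OF head_in_verts[OF e]] by (simp flip: mult.assoc add: mult_right_mono)
    qed
    then have "(\<Sum>e\<in>out_arcs G u. \<rho> e powr t * h (head G e))
        \<le> q * (\<Sum>e\<in>out_arcs G u. \<rho> e powr t' * h (head G e))"
      unfolding sum_distrib_left by (rule sum_mono)
    then show "(\<Sum>e\<in>out_arcs G u. \<rho> e powr t * h (head G e)) \<le> h u - 1"
      using h_eq[OF u] by linarith
  qed
qed

section \<open>Covering estimates for the inhomogeneous fractal\<close>

lemma covering_number_inhomogeneous_le:
  assumes inh: "inhomogeneous_gd_fractal G f C F" and u: "u \<in> verts G" and \<delta>: "\<delta> > 0"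
  shows "covering_number \<delta> (F u)
    \<le> (\<Sum>e\<in>out_arcs G u. covering_number \<delta> (f e ` F (head G e))) + covering_number \<delta> (C u)"
proof -
  have comp: "compact (f e ` F (head G e))" if "e \<in> out_arcs G u" for e
  proof (rule compact_continuous_image)
    show "continuous_on (F (head G e)) (f e)"
      using that contraction[of e] lipschitz_on_continuous_on continuous_on_subset
      by (metis in_out_arcs_conv top_greatest)
    show "compact (F (head G e))"
      using head_in_verts that inh unfolding inhomogeneous_gd_fractal_def by (metis in_out_arcs_conv)
  qed
  have eq: "F u = (\<Union>e\<in>out_arcs G u. f e ` F (head G e)) \<union> C u"
    using inh u unfolding inhomogeneous_gd_fractal_def by blast
  have "covering_number \<delta> ((\<Union>e\<in>out_arcs G u. f e ` F (head G e)) \<union> C u)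
      \<le> covering_number \<delta> (\<Union>e\<in>out_arcs G u. f e ` F (head G e)) + covering_number \<delta> (C u)"
    using comp condensation[OF u] \<delta> by (intro covering_number_Un_le compact_UN) auto
  then have "covering_number \<delta> (F u)
      \<le> covering_number \<delta> (\<Union>e\<in>out_arcs G u. f e ` F (head G e)) + covering_number \<delta> (C u)"
    unfolding eq[symmetric] .
  also have "covering_number \<delta> (\<Union>e\<in>out_arcs G u. f e ` F (head G e))
      \<le> (\<Sum>e\<in>out_arcs G u. covering_number \<delta> (f e ` F (head G e)))"
    using comp \<delta> by (intro covering_number_UN_le) auto
  finally show ?thesis by simp
qed

text \<open>The upper bound for a single exponent \<open>t\<close>. All condensation sets must have
  dimension below \<open>t\<close>, since the pieces of \<open>F u\<close> are images of the
  fractals at other vertices and carry their condensation sets along.\<close>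

lemma upper_box_dim_inhomogeneous_le:
  assumes inh: "inhomogeneous_gd_fractal G f C F"
    and sr: "mw_spectral_radius G N v \<rho> t' < 1" and t: "t' < t" "0 < t"
    and dimC: "\<And>u. u \<in> verts G \<Longrightarrow> upper_box_dim (C u) < ereal t"
    and u: "u \<in> verts G"
  shows "upper_box_dim (F u) \<le> ereal t"
proof -
  have F: "compact (F w)" "F w \<noteq> {}" if "w \<in> verts G" for w
    using inh that unfolding inhomogeneous_gd_fractal_def by blast+
  obtain h where h: "\<And>w. w \<in> verts G \<Longrightarrow> 1 \<le> h w"
    "\<And>w. w \<in> verts G \<Longrightarrow> (\<Sum>e\<in>out_arcs G w. \<rho> e powr t * h (head G e)) \<le> h w - 1"
    using subinvariant_weight[OF sr t(1)] by blast
  obtain r where r: "0 < r" "r < 1" "\<forall>e\<in>arcs G. \<rho> e \<le> r"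
    using ratio_uniform by blast
  have "eventually (\<lambda>\<delta>. \<forall>w\<in>verts G. real (covering_number \<delta> (C w)) \<le> \<delta> powr (-t)) (at_right 0)"
    using dimC condensation by (intro eventually_ball_finite) (auto intro: upper_box_dim_lessD)
  then obtain b where b: "b > 0" "\<And>\<delta> w. \<lbrakk>0 < \<delta>; \<delta> < b; w \<in> verts G\<rbrakk>
      \<Longrightarrow> real (covering_number \<delta> (C w)) \<le> \<delta> powr (-t)"
    unfolding eventually_at_right_field by blast
  \<comment> \<open>Below 1, \<open>\<delta> powr (-t)\<close> is at least 1 and so can absorb
    constants.\<close>
  define \<delta>\<^sub>0 where "\<delta>\<^sub>0 = min b 1"
  have \<delta>\<^sub>0: "0 < \<delta>\<^sub>0" "\<delta>\<^sub>0 \<le> b" "\<delta>\<^sub>0 \<le> 1" using b by (auto simp: \<delta>\<^sub>0_def)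
  \<comment> \<open>A common bound at the fixed scale \<open>\<delta>\<^sub>0\<close>, to pay for
    the edges that contract this scale to \<delta> or less.\<close>
  define A where "A = (\<Sum>w\<in>verts G. real (covering_number \<delta>\<^sub>0 (F w)))"
  have A: "real (covering_number \<delta>\<^sub>0 (F w)) \<le> A" if "w \<in> verts G" for w
    unfolding A_def using that by (intro member_le_sum) auto
  have A0: "0 \<le> A" unfolding A_def by (simp add: sum_nonneg)
  \<comment> \<open>\<open>K\<close> is the coefficient of \<open>\<delta> powr (-t)\<close> in the
    total cost at one vertex: 1 for the condensation set and at most \<open>A\<close> for each
    edge.\<close>
  define K where "K = 1 + real (card (arcs G)) * A"
  have K: "K > 0" using A0 by (simp add: K_def add_pos_nonneg)
  \<comment> \<open>Induction on the number \<open>n\<close> of factors \<open>r\<close> separating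
    \<delta> from \<open>\<delta>\<^sub>0\<close>; for \<open>n = 0\<close> there is no such scale.
    Passing from \<delta> to \<delta>/\<rho>_e lowers \<open>n\<close> by one because \<rho>_e \<le>
    r.\<close>
  have bound: "real (covering_number \<delta> (F w)) \<le> K * h w * \<delta> powr (-t)"
    if "0 < \<delta>" "\<delta> < \<delta>\<^sub>0" "\<delta>\<^sub>0 * r ^ n \<le> \<delta>" "w \<in> verts G" for n \<delta> w
    using that
  proof (induction n arbitrary: \<delta> w)
    case (Suc n)
    have edge: "real (covering_number \<delta> (f e ` F (head G e)))
        \<le> A + \<delta> powr (-t) * K * (\<rho> e powr t * h (head G e))" if "e \<in> out_arcs G w" for e
    proof -
      have e: "e \<in> arcs G" "head G e \<in> verts G" using that by auto
      have hn: "0 \<le> h (head G e)" using h(1)[OF e(2)] by simp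
      have lip: "(\<rho> e)-lipschitz_on (F (head G e)) (f e)"
        using contraction[OF e(1)] by (rule lipschitz_on_subset) simp
      note cov = covering_number_lipschitz_image_le[OF lip F(1)[OF e(2)]]
      show ?thesis
      \<comment> \<open>In the first case, which contains ratio 0, a cover at scale
        \<open>\<delta>\<^sub>0\<close> maps to one at scale \<delta>. In the second,
        \<delta>/\<rho>_e is still below \<open>\<delta>\<^sub>0\<close>, so the induction
        hypothesis applies.\<close>
      proof (cases "\<rho> e * \<delta>\<^sub>0 \<le> \<delta>")
        case True
        then have "real (covering_number \<delta> (f e ` F (head G e))) \<le> A"
          using cov[of \<delta>\<^sub>0 \<delta>] \<delta>\<^sub>0(1) A[OF e(2)] by linarith
        moreover have "0 \<le> \<delta> powr (-t) * K * (\<rho> e powr t * h (head G e))"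
          using K hn by simp
        ultimately show ?thesis by linarith
      next
        case False
        then have pos: "0 < \<rho> e"
          using Suc.prems(1) ratio[OF e(1)] by (cases "\<rho> e = 0") auto
        have "\<delta>\<^sub>0 * r ^ n * \<rho> e \<le> \<delta>\<^sub>0 * r ^ n * r"
          using r(1) bspec[OF r(3) e(1)] \<delta>\<^sub>0(1) by (intro mult_left_mono) auto
        also have "\<dots> \<le> \<delta>" using Suc.prems(3) by (simp add: mult_ac)
        finally have "\<delta>\<^sub>0 * r ^ n \<le> \<delta> / \<rho> e" using pos by (simp add: pos_le_divide_eq)
        moreover have "\<delta> / \<rho> e < \<delta>\<^sub>0" using False pos by (simp add: pos_divide_less_eq mult_ac)
        ultimately have "real (covering_number (\<delta> / \<rho> e) (F (head G e)))
            \<le> K * h (head G e) * (\<delta> / \<rho> e) powr (-t)"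
          using Suc.IH[of "\<delta> / \<rho> e" "head G e"] Suc.prems(1) pos e(2) by simp
        also have "(\<delta> / \<rho> e) powr (-t) = \<delta> powr (-t) * \<rho> e powr t"
          using Suc.prems(1) pos by (simp add: powr_divide powr_minus field_simps)
        finally have "real (covering_number \<delta> (f e ` F (head G e)))
            \<le> \<delta> powr (-t) * K * (\<rho> e powr t * h (head G e))"
          using cov[of "\<delta> / \<rho> e" \<delta>] Suc.prems(1) pos by (simp add: mult_ac)
        then show ?thesis using A0 by linarith
      qed
    qed
    have one: "1 \<le> \<delta> powr (-t)"
      using Suc.prems(1,2) \<delta>\<^sub>0(3) t(2) powr_mono_both[of "-t" 0 \<delta> 1]
      by (simp add: powr_minus one_le_inverse powr_le1)
    have "real (covering_number \<delta> (F w))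
        \<le> real ((\<Sum>e\<in>out_arcs G w. covering_number \<delta> (f e ` F (head G e))) + covering_number \<delta> (C w))"
      using covering_number_inhomogeneous_le[OF inh Suc.prems(4,1)] by (rule of_nat_mono)
    also have "\<dots> \<le> (\<Sum>e\<in>out_arcs G w. A + \<delta> powr (-t) * K * (\<rho> e powr t * h (head G e))) + \<delta> powr (-t)"
      unfolding of_nat_add of_nat_sum
      using edge b(2)[of \<delta> w] Suc.prems \<delta>\<^sub>0(2) by (intro add_mono sum_mono) auto
    also have "\<dots> = real (card (out_arcs G w)) * A
        + \<delta> powr (-t) * K * (\<Sum>e\<in>out_arcs G w. \<rho> e powr t * h (head G e)) + \<delta> powr (-t)"
      by (simp add: sum.distrib sum_distrib_left)
    also have "\<dots> \<le> real (card (arcs G)) * A * \<delta> powr (-t)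
        + \<delta> powr (-t) * K * (h w - 1) + \<delta> powr (-t)"
    proof -
      have "real (card (out_arcs G w)) * A \<le> real (card (arcs G)) * A"
        using A0 by (intro mult_right_mono of_nat_mono card_mono) auto
      also have "\<dots> \<le> real (card (arcs G)) * A * \<delta> powr (-t)"
        using one A0 mult_left_mono[of 1 "\<delta> powr (-t)" "real (card (arcs G)) * A"] by simp
      finally show ?thesis
        using h(2)[OF Suc.prems(4)] K by (intro add_mono mult_left_mono) auto
    qed
    \<comment> \<open>The slack \<open>K * \<delta> powr (-t)\<close> from \<open>h w - 1\<close>
      cancels the other two terms exactly, by the choice of \<open>K\<close>.\<close>
    also have "\<dots> = K * h w * \<delta> powr (-t)"
      unfolding K_def by (simp add: algebra_simps)
    finally show ?case .
  qed simp
  show ?thesis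
  proof (rule upper_box_dim_leI[OF F[OF u], of "K * h u" \<delta>\<^sub>0])
    show "K * h u > 0" using K h(1)[OF u] by simp
    show "\<delta>\<^sub>0 > 0" by (rule \<delta>\<^sub>0)
    fix \<delta> assume \<delta>: "0 < \<delta>" "\<delta> < \<delta>\<^sub>0"
    \<comment> \<open>As \<open>r < 1\<close>, every scale below \<open>\<delta>\<^sub>0\<close> is
      reached by the induction for some \<open>n\<close>.\<close>
    obtain n where "r ^ n < \<delta> / \<delta>\<^sub>0"
      using real_arch_pow_inv[of "\<delta> / \<delta>\<^sub>0" r] \<delta> \<delta>\<^sub>0(1) r(2) by auto
    then have "\<delta>\<^sub>0 * r ^ n \<le> \<delta>"
      using \<delta>\<^sub>0(1) by (simp add: pos_less_divide_eq mult_ac)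
    then show "real (covering_number \<delta> (F u)) \<le> K * h u * \<delta> powr (-t)"
      using bound \<delta> u by blast
  qed
qed

end

section \<open>The two bounds on the dimension\<close>

theorem corollary4p13p1:
  fixes G :: "('v, 'e) pre_digraph"
    and N :: nat
    and v :: "nat \<Rightarrow> 'v"
    and f :: "'e \<Rightarrow> real ^ 'n \<Rightarrow> real ^ 'n"
    and \<rho> :: "'e \<Rightarrow> real"
    and C F F\<^sub>\<phi> :: "'v \<Rightarrow> (real ^ 'n) set"
    and s :: real
  assumes "gdifs G N v f \<rho> C"
    and "continuous_on {0..} (mw_spectral_radius G N v \<rho>)"
    and "strict_antimono_on {0..} (mw_spectral_radius G N v \<rho>)"
    and "mw_spectral_radius G N v \<rho> 0 \<ge> 1"
    and "(mw_spectral_radius G N v \<rho> \<longlongrightarrow> 0) at_top"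
    and "is_mw_dimension G N v \<rho> s"
    and "\<forall>i\<in>{1..N}. \<forall>j\<in>{1..N}. upper_box_dim (C (v i)) = upper_box_dim (C (v j))"
    and "inhomogeneous_gd_fractal G f C F"
    and "homogeneous_gd_fractal G f F\<^sub>\<phi>"
  shows "\<forall>i\<in>{1..N}.
           max (upper_box_dim (F\<^sub>\<phi> (v i))) (upper_box_dim (C (v i))) \<le> upper_box_dim (F (v i)) \<and>
           upper_box_dim (F (v i)) \<le> max (ereal s) (upper_box_dim (C (v i)))"
proof
  fix i assume i: "i \<in> {1..N}"
  interpret gdifs G N v f \<rho> C by (rule assms(1))
  have vi: "v i \<in> verts G"
    using enumeration i by (auto simp: bij_betw_def)
  have F: "compact (F (v i))" "F (v i) \<noteq> {}" "C (v i) \<subseteq> F (v i)"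
    using assms(8) vi unfolding inhomogeneous_gd_fractal_def by blast+
  have F\<^sub>\<phi>: "compact (F\<^sub>\<phi> (v i))" "F\<^sub>\<phi> (v i) \<noteq> {}"
    using assms(9) vi unfolding homogeneous_gd_fractal_def by blast+
  have lower: "max (upper_box_dim (F\<^sub>\<phi> (v i))) (upper_box_dim (C (v i))) \<le> upper_box_dim (F (v i))"
    using upper_box_dim_mono[OF F(1) homogeneous_subset_inhomogeneous[OF assms(9,8) vi] F\<^sub>\<phi>]
      upper_box_dim_mono[OF F(1,3)] condensation[OF vi] by simp
  have upper: "upper_box_dim (F (v i)) \<le> max (ereal s) (upper_box_dim (C (v i)))"
  \<comment> \<open>It suffices to bound the dimension by every \<open>x\<close> above the maximum;
    only a real \<open>x\<close> needs an argument, since infinity is trivial and minus infinity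
    cannot lie above \<open>s\<close>.\<close>
  proof (rule dense_ge)
    fix x assume x: "max (ereal s) (upper_box_dim (C (v i))) < x"
    show "upper_box_dim (F (v i)) \<le> x"
    proof (cases x)
      case (real t)
      have s: "0 < s" "mw_spectral_radius G N v \<rho> s = 1" "s < t"
        using assms(6) x real by (auto simp: is_mw_dimension_def)
      then obtain t' where t': "s < t'" "t' < t" using dense by blast
      \<comment> \<open>Strict decrease past \<open>s\<close>, where the spectral radius is
        1.\<close>
      have "mw_spectral_radius G N v \<rho> t' < 1"
        using monotone_onD[OF assms(3), of s t'] s t'(1) by simp
      \<comment> \<open>Equality of the dimensions carries the bound from \<open>C (v i)\<close> to
        the condensation sets at all vertices.\<close>
      moreover have "upper_box_dim (C u) < ereal t" if u: "u \<in> verts G" for u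
      proof -
        obtain j where "j \<in> {1..N}" "u = v j"
          using enumeration u unfolding bij_betw_def by blast
        then have "upper_box_dim (C u) = upper_box_dim (C (v i))"
          using assms(7) i by blast
        then show ?thesis using x real by simp
      qed
      ultimately show ?thesis
        using upper_box_dim_inhomogeneous_le[OF assms(8) _ t'(2) _ _ vi] s real by simp
    qed (use x in auto)
  qed
  from lower upper show "max (upper_box_dim (F\<^sub>\<phi> (v i))) (upper_box_dim (C (v i)))
      \<le> upper_box_dim (F (v i)) \<and>
      upper_box_dim (F (v i)) \<le> max (ereal s) (upper_box_dim (C (v i)))" ..
qed

end
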